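(* $-W_1+W_2=\gamma$, where $\gamma$ is the Euler constant.
   Context: Consider all pairs $(q,k)$ with $q$ prime and $k\ge 1$ an integer, with value $z_{q,k}:=q+q^2+\cdots+q^k$, enumerated as $(q_i,k_i)$, $i\ge1$, with $z_i:=z_{q_i,k_i}$ nondecreasing (each pair counted once, so equal values from different pairs are counted with multiplicity). Define $W_1:=\sum_{i=1}^\infty\left(\frac1{z_i}-\log\left(1+\frac1{z_i}\right)\right)$ and $W_2:=M+\sum_{q\ \text{prime},\,k\ge2}\frac{1}{z_{q,k}}$ (the sum over all non-prime values in the list, i.e. the pairs with $k\ge2$), where $M:=\gamma+\sum_p\left(\log(1-1/p)+1/p\right)$ is the Meissel–Mertens constant. *)

theory Defs
  imports "HOL-Analysis.Analysis" "HOL-Computational_Algebra.Primes"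
begin

definition pp_pairs :: "(nat \<times> nat) set" where
  "pp_pairs = {(q, k). prime q \<and> k \<ge> 1}"

definition zval :: "nat \<times> nat \<Rightarrow> nat" where
  "zval = (\<lambda>(q, k). \<Sum>j = 1..k. q ^ j)"

(* Enumerations are indexed from 0, so e i is the pair with number i + 1.
   Ties between equal values may be broken in any way. *)
definition pp_enumeration :: "(nat \<Rightarrow> nat \<times> nat) \<Rightarrow> bool" where
  "pp_enumeration e \<longleftrightarrow> bij_betw e UNIV pp_pairs \<and> mono (\<lambda>i. zval (e i))"

definition W1 :: "(nat \<Rightarrow> nat \<times> nat) \<Rightarrow> real" where
  "W1 e = (\<Sum>i. 1 / real (zval (e i)) - ln (1 + 1 / real (zval (e i))))"

definition meissel_mertens :: real where
  "meissel_mertens =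
     euler_mascheroni + (\<Sum>\<^sub>\<infinity>p\<in>{p::nat. prime p}. ln (1 - 1 / real p) + 1 / real p)"

definition W2 :: real where
  "W2 = meissel_mertens + (\<Sum>\<^sub>\<infinity>(q, k)\<in>{(q, k). prime q \<and> k \<ge> 2}. 1 / real (zval (q, k)))"


(* The lemmas below show that an enumeration exists and that all three series above converge,
   so none of the sums takes the default value 0. *)

lemma power_le_z:
  assumes "k \<ge> 1"
  shows "q ^ k \<le> zval (q, k)"
  unfolding zval_def prod.case by (rule member_le_sum) (use assms in auto)

lemma z_ge_2:
  assumes "prime q" "k \<ge> 1"
  shows "zval (q, k) \<ge> 2"
proof -
  have "2 \<le> q" using assms(1) by (rule prime_ge_2_nat)
  also have "q \<le> q ^ k" using assms \<open>2 \<le> q\<close> by (intro self_le_power) auto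
  also have "\<dots> \<le> zval (q, k)" using assms(2) by (rule power_le_z)
  finally show ?thesis .
qed

lemma z_inj_left:
  assumes "zval (q, k) = zval (q', k)" "k \<ge> 1"
  shows "q = q'"
proof -
  have less: "zval (a, k) < zval (b, k)" if "a < b" for a b
    unfolding zval_def prod.case
    by (rule sum_strict_mono) (use that assms(2) in \<open>auto intro: power_strict_mono\<close>)
  show ?thesis using less[of q q'] less[of q' q] assms(1) by (metis less_irrefl linorder_neqE_nat)
qed

lemma pp_enumeration_exists: "\<exists>e. pp_enumeration e"
proof -
  define key where "key = (\<lambda>x. zval x * (zval x + 1) + snd x)"
  have k_le: "snd x \<le> zval x" if "x \<in> pp_pairs" for x
  proof -
    obtain q k where x: "x = (q, k)" by (cases x)
    then have "prime q" "k \<ge> 1" using that by (auto simp: pp_pairs_def)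
    have "k < 2 ^ k" by (rule less_exp)
    also have "\<dots> \<le> q ^ k" using \<open>prime q\<close> by (intro power_mono prime_ge_2_nat) auto
    also have "\<dots> \<le> zval (q, k)" using \<open>k \<ge> 1\<close> by (rule power_le_z)
    finally show ?thesis by (simp add: x)
  qed
  have key_less: "key x < key y" if "x \<in> pp_pairs" "zval x < zval y" for x y
  proof -
    have "key x < (zval x + 1) * (zval x + 1)" using k_le[OF that(1)] by (simp add: key_def)
    also have "\<dots> \<le> zval y * (zval y + 1)" using that(2) by (intro mult_le_mono) auto
    also have "\<dots> \<le> key y" by (simp add: key_def)
    finally show ?thesis .
  qed
  have inj: "inj_on key pp_pairs"
  proof (rule inj_onI)
    fix x y assume xy: "x \<in> pp_pairs" "y \<in> pp_pairs" "key x = key y"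
    then have zz: "zval x = zval y" using key_less[of x y] key_less[of y x] by (metis less_irrefl linorder_neqE_nat)
    with xy(3) have kk: "snd x = snd y" by (simp add: key_def)
    show "x = y"
      using z_inj_left[of "fst x" "snd x" "fst y"] zz kk xy(1)
      by (cases x, cases y) (auto simp: pp_pairs_def)
  qed
  have "(\<lambda>p. (p, 1)) ` {p::nat. prime p} \<subseteq> pp_pairs" by (auto simp: pp_pairs_def)
  moreover have "infinite ((\<lambda>p. (p, 1::nat)) ` {p::nat. prime p})"
    using primes_infinite by (subst finite_image_iff) (auto intro: inj_onI)
  ultimately have "infinite pp_pairs" using finite_subset by blast
  then have inf: "infinite (key ` pp_pairs)" using finite_image_iff[OF inj] by simp
  define e where "e = the_inv_into pp_pairs key \<circ> enumerate (key ` pp_pairs)"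
  have bij: "bij_betw e UNIV pp_pairs"
    unfolding e_def
    by (rule bij_betw_trans[OF bij_enumerate[OF inf] bij_betw_the_inv_into])
       (use inj in \<open>simp add: bij_betw_def\<close>)
  have key_e: "key (e i) = enumerate (key ` pp_pairs) i" for i
    unfolding e_def o_def by (rule f_the_inv_into_f[OF inj enumerate_in_set[OF inf]])
  have "mono (\<lambda>i. zval (e i))"
  proof (rule monoI, rule ccontr)
    fix i j :: nat assume "i \<le> j" "\<not> zval (e i) \<le> zval (e j)"
    moreover have "e j \<in> pp_pairs" using bij by (auto simp: bij_betw_def)
    ultimately have "key (e j) < key (e i)" by (intro key_less) auto
    then show False using \<open>i \<le> j\<close> inf by (simp add: key_e)
  qed
  with bij show ?thesis unfolding pp_enumeration_def by blast
qed

lemma summable_prime_powers: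
  "(\<lambda>(q, k). 1 / real q ^ k) summable_on {(q::nat, k::nat). prime q \<and> k \<ge> 2}"
proof -
  have 1: "(\<lambda>q. 1 / real q ^ 2) summable_on {q. prime q}"
  proof (rule summable_on_subset_banach)
    show "(\<lambda>q. 1 / real q ^ 2) summable_on (UNIV :: nat set)"
      using inverse_power_summable[of 2, where ?'a = real]
      by (subst summable_on_UNIV_nonneg_real_iff) (auto simp: field_simps)
  qed auto
  have geo: "((\<lambda>k. 1 / real q ^ k) has_sum (1 / real q ^ 2 / (1 - 1 / real q))) {2..}"
    if "prime q" for q :: nat
  proof -
    have q: "real q \<ge> 2" using prime_ge_2_nat[OF that] by simp
    have "(\<lambda>n. (1 / real q) ^ n) sums (1 / (1 - 1 / real q))"
      using q by (intro geometric_sums) auto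
    from sums_mult[OF this, of "1 / real q ^ 2"]
    have "(\<lambda>n. 1 / real q ^ (n + 2)) sums (1 / real q ^ 2 / (1 - 1 / real q))"
      by (simp add: power_add power_divide power2_eq_square mult_ac)
    then have "((\<lambda>n. 1 / real q ^ (n + 2)) has_sum (1 / real q ^ 2 / (1 - 1 / real q))) UNIV"
      by (intro norm_summable_imp_has_sum) (auto simp: sums_iff)
    then show ?thesis
      by (subst has_sum_reindex_bij_witness[of _ "\<lambda>n. n + 2" "\<lambda>n. n - 2" UNIV "\<lambda>n. 1 / real q ^ (n + 2)"])
         (auto simp del: power_Suc add_2_eq_Suc')
  qed
  have 2: "(\<lambda>q. 1 / real q ^ 2 / (1 - 1 / real q)) summable_on {q. prime q}"
  proof (rule summable_on_comparison_test[OF summable_on_cmult_right[OF 1, of 2]])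
    fix q :: nat assume "q \<in> {q. prime q}"
    then have q: "real q \<ge> 2" using prime_ge_2_nat[of q] by simp
    then have "1 / 2 \<le> 1 - 1 / real q" by (simp add: field_simps)
    then have "1 / (1 - 1 / real q) \<le> 2" by (simp add: field_simps)
    from mult_left_mono[OF this, of "1 / real q ^ 2"]
    show "1 / real q ^ 2 / (1 - 1 / real q) \<le> 2 * (1 / real q ^ 2)" by simp
    show "0 \<le> 1 / real q ^ 2 / (1 - 1 / real q)" using q by simp
  qed
  have "(\<lambda>(q, k). 1 / real q ^ k) summable_on Sigma {q::nat. prime q} (\<lambda>_. {2::nat..})"
    by (rule summable_on_SigmaI[OF _ 2]) (use geo in auto)
  also have "Sigma {q::nat. prime q} (\<lambda>_. {2::nat..}) = {(q, k). prime q \<and> k \<ge> 2}" by auto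
  finally show ?thesis .
qed

lemma summable_W1:
  assumes "pp_enumeration e"
  shows "summable (\<lambda>i. 1 / real (zval (e i)) - ln (1 + 1 / real (zval (e i))))"
proof -
  have inj: "inj_on (\<lambda>(q, k). (q, 2 * k)) pp_pairs" by (auto intro: inj_onI)
  have "(\<lambda>(q, k). 1 / real q ^ k) summable_on ((\<lambda>(q, k). (q, 2 * k)) ` pp_pairs)"
    by (rule summable_on_subset_banach[OF summable_prime_powers]) (auto simp: pp_pairs_def)
  then have "(\<lambda>(q, k). 1 / real q ^ (2 * k)) summable_on pp_pairs"
    by (subst (asm) summable_on_reindex[OF inj]) (simp add: o_def case_prod_unfold)
  from summable_on_cmult_right[OF this, of 2]
  have "(\<lambda>x. norm (1 / real (zval x) - ln (1 + 1 / real (zval x)))) summable_on pp_pairs"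
  proof (rule Infinite_Sum.abs_summable_on_comparison_test')
    fix x assume "x \<in> pp_pairs"
    then obtain q k where x: "x = (q, k)" "prime q" "k \<ge> 1" by (auto simp: pp_pairs_def)
    have q: "q > 0" using x(2) by (rule prime_gt_0_nat)
    have z2: "real (zval x) \<ge> 2" using z_ge_2[OF x(2,3)] x(1) by simp
    have "norm (1 / real (zval x) - ln (1 + 1 / real (zval x))) \<le> 2 * (1 / real (zval x))\<^sup>2"
      using abs_ln_one_plus_x_minus_x_bound[of "1 / real (zval x)"] z2 by (simp add: abs_minus_commute)
    also have "\<dots> \<le> 2 * (1 / real q ^ k)\<^sup>2"
    proof -
      have "real q ^ k \<le> real (zval x)"
        using power_le_z[OF x(3), of q] unfolding x(1) by (simp flip: of_nat_power)
      then have "1 / real (zval x) \<le> 1 / real q ^ k"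
        using q by (intro frac_le) auto
      then show ?thesis by (intro mult_left_mono power_mono) auto
    qed
    also have "(1 / real q ^ k)\<^sup>2 = 1 / real q ^ (2 * k)"
      by (simp add: power_divide mult.commute flip: power_mult)
    finally show "norm (1 / real (zval x) - ln (1 + 1 / real (zval x)))
        \<le> 2 * (case x of (q, k) \<Rightarrow> 1 / real q ^ (2 * k))"
      by (simp add: x(1))
  qed
  then have "(\<lambda>x. 1 / real (zval x) - ln (1 + 1 / real (zval x))) summable_on pp_pairs"
    by (rule abs_summable_summable)
  then have "(\<lambda>i. 1 / real (zval (e i)) - ln (1 + 1 / real (zval (e i)))) summable_on UNIV"
    using assms unfolding pp_enumeration_def
    by (subst summable_on_reindex_bij_betw[of e UNIV pp_pairs]) auto
  then show ?thesis by (rule summable_on_imp_summable)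
qed

lemma summable_meissel_mertens:
  "(\<lambda>p. ln (1 - 1 / real p) + 1 / real p) summable_on {p. prime p}"
proof -
  have "(\<lambda>q. 1 / real q ^ 2) summable_on (UNIV :: nat set)"
    using inverse_power_summable[of 2, where ?'a = real]
    by (subst summable_on_UNIV_nonneg_real_iff) (auto simp: field_simps)
  then have "(\<lambda>q. 1 / real q ^ 2) summable_on {q. prime q}"
    by (rule summable_on_subset_banach) auto
  from summable_on_cmult_right[OF this, of 2]
  have "(\<lambda>p. norm (ln (1 - 1 / real p) + 1 / real p)) summable_on {p. prime p}"
  proof (rule Infinite_Sum.abs_summable_on_comparison_test')
    fix p :: nat assume "p \<in> {p. prime p}"
    then have "real p \<ge> 2" using prime_ge_2_nat[of p] by simp
    then show "norm (ln (1 - 1 / real p) + 1 / real p) \<le> 2 * (1 / real p ^ 2)"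
      using abs_ln_one_plus_x_minus_x_bound[of "- (1 / real p)"] by (simp add: power_divide)
  qed
  then show ?thesis by (rule abs_summable_summable)
qed

lemma summable_W2:
  "(\<lambda>(q, k). 1 / real (zval (q, k))) summable_on {(q, k). prime q \<and> k \<ge> 2}"
proof (rule summable_on_comparison_test[OF summable_prime_powers])
  fix x :: "nat \<times> nat" assume "x \<in> {(q, k). prime q \<and> k \<ge> 2}"
  then obtain q k where x: "x = (q, k)" "prime q" "k \<ge> 2" by auto
  have "q > 0" using x(2) by (rule prime_gt_0_nat)
  moreover have "real q ^ k \<le> real (zval (q, k))"
    using power_le_z[of k q] x(3) by (simp flip: of_nat_power)
  ultimately have "1 / real (zval (q, k)) \<le> 1 / real q ^ k"
    by (intro frac_le) auto
  then show "(case x of (q, k) \<Rightarrow> 1 / real (zval (q, k))) \<le> (case x of (q, k) \<Rightarrow> 1 / real q ^ k)"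
    by (simp add: x(1))
qed auto

end

(* Writing S_k = 1 + q + ... + q^k, one has 1 + 1/z_{q,k} = S_k / (q S_{k-1}). For fixed q the
   logarithms therefore telescope, and their sum over k is lim ln (S_k / q^k) = - ln (1 - 1/q).
   The contribution of q to W1 is thus (ln (1 - 1/q) + 1/q) + sum_{k >= 2} 1/z_{q,k}, and summing
   over the primes gives W1 = (M - gamma) + (W2 - M). *)

theory Submission
  imports Defs
begin

lemma real_zval_mult:
  "(real q - 1) * real (zval (q, k)) = real q ^ Suc k - real q"
  by (induction k) (simp_all add: zval_def algebra_simps)

text \<open>Inserting the closed form of the geometric sum and cancelling powers of q leaves a
  quotient of consecutive terms 1 - q^(-k). Unlike S_k itself, these terms have a finite limit, so
  the telescoping sum can be evaluated directly.\<close>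

lemma ln_one_plus_inverse_zval:
  assumes "q \<ge> 2" "k \<ge> 1"
  shows "ln (1 + 1 / real (zval (q, k))) =
    ln (1 - (1 / real q) ^ Suc k) - ln (1 - (1 / real q) ^ k)"
proof -
  have q: "real q \<ge> 2" using assms by simp
  have qk: "real q ^ k > 1" using q assms by (intro one_less_power) auto
  have "real q ^ Suc k > real q" using qk q by simp
  with real_zval_mult[of q k] have z: "real (zval (q, k)) = (real q ^ Suc k - real q) / (real q - 1)"
    using q by (simp add: field_simps)
  have "1 + 1 / real (zval (q, k)) = (1 - (1 / real q) ^ Suc k) / (1 - (1 / real q) ^ k)"
    unfolding z using q qk \<open>real q ^ Suc k > real q\<close> by (simp add: field_simps)
  moreover have "(1 / real q) ^ Suc k < 1" "(1 / real q) ^ k < 1"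
    using q assms by (auto intro!: power_Suc_less_one power_less_one_iff[THEN iffD2]
        simp del: power_Suc)
  ultimately show ?thesis by (simp add: ln_div)
qed

lemma has_sum_ln_one_plus_inverse_zval:
  assumes "q \<ge> 2"
  shows "((\<lambda>k. ln (1 + 1 / real (zval (q, k)))) has_sum - ln (1 - 1 / real q)) {1..}"
proof -
  \<comment> \<open>The shift to \<open>Suc n\<close> starts the telescope at k = 1; its limit is 0,
    so only minus the initial term ln (1 - 1/q) survives.\<close>
  have "(\<lambda>n. ln (1 - (1 / real q) ^ Suc n)) \<longlonglongrightarrow> ln (1 - 0)"
    using assms by (intro tendsto_intros LIMSEQ_power_zero[THEN LIMSEQ_Suc]) auto
  from telescope_sums[OF this]
  have "(\<lambda>n. ln (1 + 1 / real (zval (q, Suc n)))) sums (- ln (1 - 1 / real q))"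
    using assms by (simp add: ln_one_plus_inverse_zval del: power_Suc)
  then have "((\<lambda>n. ln (1 + 1 / real (zval (q, Suc n)))) has_sum (- ln (1 - 1 / real q))) UNIV"
    by (intro norm_summable_imp_has_sum) (auto simp: sums_iff)
  then show ?thesis
    by (subst has_sum_reindex_bij_witness[of _ Suc "\<lambda>n. n - 1" UNIV
          "\<lambda>n. ln (1 + 1 / real (zval (q, Suc n)))"]) auto
qed

text \<open>Since ln (1 + x) \<le> x for x \<ge> 0, all terms are nonnegative. The series may
  therefore be rearranged into an unordered sum over the pairs, ready to be grouped by
  primes.\<close>

lemma has_sum_W1:
  assumes "pp_enumeration e"
  shows "((\<lambda>x. 1 / real (zval x) - ln (1 + 1 / real (zval x))) has_sum W1 e) pp_pairs"
proof -
  have "0 \<le> 1 / real (zval (e i)) - ln (1 + 1 / real (zval (e i)))" for i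
    using ln_add_one_self_le_self[of "1 / real (zval (e i))"] by simp
  with summable_W1[OF assms]
  have "((\<lambda>i. 1 / real (zval (e i)) - ln (1 + 1 / real (zval (e i)))) has_sum W1 e) UNIV"
    unfolding W1_def by (intro norm_summable_imp_has_sum summable_sums) auto
  then show ?thesis
    using assms unfolding pp_enumeration_def
    by (subst (asm) has_sum_reindex_bij_betw[of e UNIV pp_pairs]) auto
qed

lemma has_sum_W1_prime:
  assumes "prime q"
  shows "((\<lambda>k. 1 / real (zval (q, k)) - ln (1 + 1 / real (zval (q, k)))) has_sum
    (ln (1 - 1 / real q) + 1 / real q) + (\<Sum>\<^sub>\<infinity>k\<in>{2..}. 1 / real (zval (q, k)))) {1..}"
proof -
  have "(\<lambda>x. 1 / real (zval x)) summable_on Pair q ` {2..}"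
    by (rule summable_on_subset_banach[OF summable_W2[unfolded case_prod_unfold prod.collapse]])
       (use assms in auto)
  then have "(\<lambda>k. 1 / real (zval (q, k))) summable_on {2..}"
    by (subst (asm) summable_on_reindex) (auto intro: inj_onI simp: o_def)
  \<comment> \<open>The term k = 1, where z = q, is split off: it supplies the 1/q of the
    Meissel-Mertens summand.\<close>
  then have "((\<lambda>k. 1 / real (zval (q, k))) has_sum
      1 / real (zval (q, 1)) + (\<Sum>\<^sub>\<infinity>k\<in>{2..}. 1 / real (zval (q, k)))) (insert 1 {2..})"
    by (intro has_sum_insert has_sum_infsum) auto
  moreover have "insert 1 {2..} = {1::nat..}" by auto
  ultimately have "((\<lambda>k. 1 / real (zval (q, k))) has_sum
      1 / real q + (\<Sum>\<^sub>\<infinity>k\<in>{2..}. 1 / real (zval (q, k)))) {1..}"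
    by (simp add: zval_def)
  from has_sum_add[OF this has_sum_uminus[THEN iffD2,
        OF has_sum_ln_one_plus_inverse_zval[OF prime_ge_2_nat[OF assms]]]]
  show ?thesis by (simp add: algebra_simps)
qed

theorem theorem3:
  fixes e :: "nat \<Rightarrow> nat \<times> nat"
  assumes "pp_enumeration e"
  shows "- W1 e + W2 = euler_mascheroni"
proof -
  define R where "R = (\<lambda>q. \<Sum>\<^sub>\<infinity>k\<in>{2..}. 1 / real (zval (q, k)))"
  have "pp_pairs = Sigma {q. prime q} (\<lambda>_. {1..})"
    by (auto simp: pp_pairs_def)
  with has_sum_W1[OF assms]
  \<comment> \<open>Fubini for unordered sums: each fibre over a prime q is replaced by its known
    sum.\<close>
  have 1: "((\<lambda>q. (ln (1 - 1 / real q) + 1 / real q) + R q) has_sum W1 e) {q. prime q}"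
    unfolding R_def by (intro has_sum_SigmaD[OF _ has_sum_W1_prime]) auto
  have "{(q, k). prime q \<and> k \<ge> 2} = Sigma {q::nat. prime q} (\<lambda>_. {2::nat..})"
    by auto
  note W2 = summable_W2[unfolded this] and W2_def' = W2_def[unfolded this]
  have 2: "R summable_on {q. prime q}"
    and 3: "(\<Sum>\<^sub>\<infinity>q\<in>{q. prime q}. R q) = W2 - meissel_mertens"
    using summable_on_Sigma_banach[OF W2] infsum_Sigma'_banach[OF W2]
    by (simp_all add: R_def W2_def')
  have "W1 e = (\<Sum>\<^sub>\<infinity>q\<in>{q. prime q}. (ln (1 - 1 / real q) + 1 / real q) + R q)"
    using infsumI[OF 1] by simp
  \<comment> \<open>Both parts are summable over the primes, so the sum splits, and the constant M
    cancels.\<close>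
  also have "\<dots> = (meissel_mertens - euler_mascheroni) + (W2 - meissel_mertens)"
    using infsum_add[OF summable_meissel_mertens 2] by (simp add: 3 meissel_mertens_def)
  finally show ?thesis by simp
qed

end
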